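(* For every $k\ge 1$, there is a bijection between the set of $4\mathbb{Z}^k$-periodic cube tilings and the set of $k$-dimensional Unique Sink Orientations (USOs).
   Context: $4\mathbb{Z}^k$-periodic cube tiling: a tiling of the $k$-dimensional cube of side length $4$, with opposite sides identified (i.e. the torus $(\mathbb{R}/4\mathbb{Z})^k$), by $2^k$ axis-parallel, integer-grid aligned $k$-cubes (tiles) of side length $2$. A tile with lower-left corner $c\in\{0,1,2,3\}^k$ occupies the set $c+[0,2]^k$, taken componentwise modulo $4$; the tiles must cover the whole cube, and any point contained in several tiles lies on the boundary of all of them. A tiling is identified with the set of the $2^k$ corners of its tiles, a subset of $\{0,1,2,3\}^k$. USO: $Q_k$ is the $k$-dimensional hypercube graph with vertex set $\{0,1\}^k$, two vertices being adjacent if they differ in exactly one coordinate. A face is the subgraph induced by all vertices that agree with a fixed string $f\in\{0,1,*\}^k$ on the non-$*$ positions. An orientation of $Q_k$ assigns a direction to each edge; it is a Unique Sink Orientation (a $k$-dimensional USO) if every face contains exactly one vertex with no outgoing edges inside that face. *)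

theory Defs
  imports "HOL-Analysis.Analysis"
begin

text \<open>Vectors of dimension \<open>k\<close> are extensional functions on \<open>{..<k}\<close>, so that sets of vectors have
  their expected cardinality.\<close>

definition euclid :: "nat \<Rightarrow> (nat \<Rightarrow> real) topology" where
  "euclid k = product_topology (\<lambda>_. euclideanreal) {..<k}"

text \<open>Subsets of the torus \<open>(\<real>/4\<int>)^k\<close> are represented by their \<open>4\<int>^k\<close>-periodic preimages in \<open>\<real>^k\<close>.
  The quotient map is a covering map, so taking preimages commutes with taking frontiers.
  Thus \<open>tile k c\<close> is the preimage of the projection of \<open>c + [0,2]^k\<close>.\<close>

definition tile :: "nat \<Rightarrow> (nat \<Rightarrow> int) \<Rightarrow> (nat \<Rightarrow> real) set" where
  "tile k c = {x \<in> topspace (euclid k).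
     \<exists>y \<in> topspace (euclid k). (\<forall>i<k. y i \<in> {real_of_int (c i)..real_of_int (c i) + 2}) \<and>
       (\<forall>i<k. \<exists>m::int. x i = y i + 4 * real_of_int m)}"

definition cube_tilings :: "nat \<Rightarrow> (nat \<Rightarrow> int) set set" where
  "cube_tilings k = {C. C \<subseteq> ({..<k} \<rightarrow>\<^sub>E {0..3}) \<and> card C = 2 ^ k \<and>
     (\<Union>c\<in>C. tile k c) = topspace (euclid k) \<and>
     (\<forall>c\<in>C. \<forall>d\<in>C. c \<noteq> d \<longrightarrow>
       tile k c \<inter> tile k d \<subseteq> (euclid k frontier_of tile k c) \<inter> (euclid k frontier_of tile k d))}"

definition cube_verts :: "nat \<Rightarrow> (nat \<Rightarrow> nat) set" where
  "cube_verts k = {..<k} \<rightarrow>\<^sub>E {0, 1}"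

definition cube_adj :: "nat \<Rightarrow> (nat \<Rightarrow> nat) \<Rightarrow> (nat \<Rightarrow> nat) \<Rightarrow> bool" where
  "cube_adj k u v \<longleftrightarrow> u \<in> cube_verts k \<and> v \<in> cube_verts k \<and> (\<exists>!i. i < k \<and> u i \<noteq> v i)"

text \<open>In a string \<open>f\<close> over \<open>{0,1,*}\<close>, the symbol \<open>*\<close> is represented by \<open>None\<close>.\<close>

definition face :: "nat \<Rightarrow> (nat \<Rightarrow> nat option) \<Rightarrow> (nat \<Rightarrow> nat) set" where
  "face k f = {v \<in> cube_verts k. \<forall>i<k. f i \<noteq> None \<longrightarrow> f i = Some (v i)}"

text \<open>An orientation is the set of its arcs: \<open>(u, v) \<in> D\<close> means that the edge \<open>{u, v}\<close> is directed
  from \<open>u\<close> to \<open>v\<close>.\<close>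

definition orientation :: "nat \<Rightarrow> ((nat \<Rightarrow> nat) \<times> (nat \<Rightarrow> nat)) set \<Rightarrow> bool" where
  "orientation k D \<longleftrightarrow> (\<forall>(u, v)\<in>D. cube_adj k u v) \<and>
     (\<forall>u v. cube_adj k u v \<longrightarrow> ((u, v) \<in> D \<longleftrightarrow> (v, u) \<notin> D))"

definition usos :: "nat \<Rightarrow> ((nat \<Rightarrow> nat) \<times> (nat \<Rightarrow> nat)) set set" where
  "usos k = {D. orientation k D \<and>
     (\<forall>f \<in> {..<k} \<rightarrow>\<^sub>E {None, Some 0, Some 1}.
        \<exists>!v. v \<in> face k f \<and> (\<forall>w \<in> face k f. (v, w) \<notin> D))}"

end

theory Submission
  imports Defs
begin

text \<open>Both sides are encoded by maps \<open>s\<close> from vertices to subsets of \<open>{..<k}\<close> such that any two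
  distinct vertices \<open>u, v\<close> have a coordinate \<open>i\<close> with \<open>u i \<noteq> v i\<close> in which also the membership of \<open>i\<close>
  in \<open>s u\<close> and \<open>s v\<close> differs. By a theorem of Szabo and Welzl, these are exactly the outmaps of USOs.
  On the other side, \<open>2^k\<close> corners form a tiling iff any two of them differ by \<open>2\<close> modulo \<open>4\<close> in some
  coordinate. Coding the pair of bits (vertex bit, outmap bit) by \<open>00, 01, 11, 10 \<mapsto> 0, 1, 2, 3\<close>,
  a difference of \<open>2\<close> modulo \<open>4\<close> means that both bits differ, which identifies the two conditions.\<close>

section \<open>Tilings as sets of corners\<close>

definition closed_arc :: "int \<Rightarrow> real set" where
  "closed_arc a = {t. \<exists>m::int. real_of_int a \<le> t - 4 * of_int m \<and> t - 4 * of_int m \<le> real_of_int a + 2}"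

definition open_arc :: "int \<Rightarrow> real set" where
  "open_arc a = {t. \<exists>m::int. real_of_int a < t - 4 * of_int m \<and> t - 4 * of_int m < real_of_int a + 2}"

lemma topspace_euclid: "topspace (euclid k) = {..<k} \<rightarrow>\<^sub>E UNIV"
  by (simp add: euclid_def)

text \<open>The multiple of 4 is chosen in each coordinate separately, so tiles can be studied one
  coordinate at a time.\<close>

lemma tile_eq_PiE: "tile k c = (\<Pi>\<^sub>E i\<in>{..<k}. closed_arc (c i))"
proof (rule set_eqI, rule iffI)
  fix x assume "x \<in> tile k c"
  then obtain y where x: "x \<in> {..<k} \<rightarrow>\<^sub>E UNIV"
    and y: "\<forall>i<k. y i \<in> {real_of_int (c i)..real_of_int (c i) + 2}"
    and m: "\<forall>i<k. \<exists>m::int. x i = y i + 4 * real_of_int m"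
    by (auto simp: tile_def topspace_euclid)
  have "x i \<in> closed_arc (c i)" if "i < k" for i
  proof -
    obtain m :: int where "x i = y i + 4 * real_of_int m" using m \<open>i < k\<close> by blast
    with y that show ?thesis unfolding closed_arc_def by (auto intro!: exI[of _ m])
  qed
  with x show "x \<in> (\<Pi>\<^sub>E i\<in>{..<k}. closed_arc (c i))" by (auto simp: PiE_iff)
next
  fix x assume x: "x \<in> (\<Pi>\<^sub>E i\<in>{..<k}. closed_arc (c i))"
  then have "\<forall>i\<in>{..<k}. \<exists>m::int. real_of_int (c i) \<le> x i - 4 * of_int m \<and> x i - 4 * of_int m \<le> real_of_int (c i) + 2"
    by (auto simp: PiE_iff closed_arc_def)
  then obtain m :: "nat \<Rightarrow> int" where m: "\<And>i. i < k \<Longrightarrow> real_of_int (c i) \<le> x i - 4 * of_int (m i) \<and> x i - 4 * of_int (m i) \<le> real_of_int (c i) + 2"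
    by (metis lessThan_iff)
  show "x \<in> tile k c"
    unfolding tile_def
  proof (intro CollectI conjI bexI[of _ "\<lambda>i\<in>{..<k}. x i - 4 * of_int (m i)"] allI impI)
    fix i assume "i < k"
    then show "\<exists>n::int. x i = (\<lambda>i\<in>{..<k}. x i - 4 * of_int (m i)) i + 4 * real_of_int n"
      by (intro exI[of _ "m i"]) simp
  qed (use x m in \<open>auto simp: topspace_euclid PiE_iff\<close>)
qed

lemma open_open_arc: "open (open_arc a)"
proof -
  have "open_arc a = (\<Union>m::int. {real_of_int a + 4 * of_int m <..< real_of_int a + 2 + 4 * of_int m})"
    by (force simp: open_arc_def algebra_simps)
  then show ?thesis by auto
qed

lemma open_arc_subset: "open_arc a \<subseteq> closed_arc a"
  unfolding open_arc_def closed_arc_def by (blast intro: less_imp_le)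

text \<open>On the circle the two arcs are complementary halves, so they share only their
  endpoints.\<close>

lemma arc_int_arc_opposite:
  assumes "(a - b) mod 4 = 2" "t \<in> closed_arc a" "t \<in> closed_arc b"
  shows "\<exists>m::int. t = real_of_int (a + 2 * m)"
proof -
  obtain m n :: int where m: "real_of_int a \<le> t - 4 * of_int m" "t - 4 * of_int m \<le> real_of_int a + 2"
    and n: "real_of_int b \<le> t - 4 * of_int n" "t - 4 * of_int n \<le> real_of_int b + 2"
    using assms(2,3) by (auto simp: closed_arc_def)
  obtain q where q: "a = b + 2 + 4 * q"
    using assms(1) by (metis add.assoc add.commute diff_add_cancel mult_div_mod_eq)
  have "real_of_int (4 * (q + m)) \<le> real_of_int (4 * n)" "real_of_int (4 * n) \<le> real_of_int (4 * (q + m) + 4)"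
    using m n q by simp_all
  then have "4 * (q + m) \<le> 4 * n" "4 * n \<le> 4 * (q + m) + 4" unfolding of_int_le_iff .
  then have "n = q + m \<or> n = q + m + 1" by presburger
  \<comment> \<open>The first case puts \<open>t\<close> at the left end of an arc from
    \<open>a\<close>, the second at its right end.\<close>
  then consider "n = q + m" | "n = q + m + 1" by blast
  then show ?thesis
  proof cases
    case 1
    then have "t = real_of_int (a + 2 * (2 * m))" using m n q by simp
    then show ?thesis by blast
  next
    case 2
    then have "t = real_of_int (a + 2 * (2 * m + 1))" using m n q by simp
    then show ?thesis by blast
  qed
qed

text \<open>The endpoints of the arcs starting in \<open>a\<close> are the points of \<open>a + 2\<int>\<close>.\<close>
lemma arc_endpoint_not_interior:
  assumes "open U" "real_of_int (a + 2 * m) \<in> U"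
  shows "\<not> U \<subseteq> closed_arc a"
proof
  assume U: "U \<subseteq> closed_arc a"
  obtain e where e: "e > 0" "\<And>y. dist y (real_of_int (a + 2 * m)) < e \<Longrightarrow> y \<in> U"
    using assms open_dist by metis
  define d where "d = min (e / 2) (1 / 2)"
  have d: "d > 0" "d < e" "d < 1" using e(1) by (auto simp: d_def)
  obtain n r where m: "m = 2 * n + r" "r = 0 \<or> r = 1"
    by (metis add_0_right evenE oddE)
  \<comment> \<open>The parity of \<open>m\<close> tells left ends (\<open>r = 0\<close>) from right
    ends. Moving outward by \<open>d\<close> stays in \<open>U\<close> and cannot reach the next
    arc, since the gaps have length 2.\<close>
  define t where "t = real_of_int (a + 2 * m) + (if r = 0 then - d else d)"
  have "t \<in> closed_arc a" using U e(2)[of t] d by (auto simp: t_def dist_real_def)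
  then obtain p :: int where p: "real_of_int a \<le> t - 4 * of_int p" "t - 4 * of_int p \<le> real_of_int a + 2"
    by (auto simp: closed_arc_def)
  show False
    using m(2)
  proof
    assume r: "r = 0"
    then have "4 * real_of_int n - d - 4 * of_int p \<ge> 0" "4 * real_of_int n - d - 4 * of_int p \<le> 2"
      using p m by (auto simp: t_def)
    with d have "real_of_int (4 * p) < of_int (4 * n)" "real_of_int (4 * n) < of_int (4 * p + 3)"
      by auto
    then show False unfolding of_int_less_iff by presburger
  next
    assume r: "r = 1"
    then have "4 * real_of_int n + 2 + d - 4 * of_int p \<ge> 0" "4 * real_of_int n + 2 + d - 4 * of_int p \<le> 2"
      using p m by (auto simp: t_def)
    with d have "real_of_int (4 * p) < of_int (4 * n + 3)" "real_of_int (4 * n) < of_int (4 * p)"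
      by auto
    then show False unfolding of_int_less_iff by presburger
  qed
qed

lemma open_arc_int_open_arc:
  assumes "(a - b) mod 4 \<noteq> 2"
  shows "open_arc a \<inter> open_arc b \<noteq> {}"
proof -
  have "\<exists>q. a = b + 4 * q \<or> a = b + 4 * q + 1 \<or> a = b + 4 * q - 1" using assms by presburger
  then obtain q r where ab: "a = b + 4 * q + r" "r \<in> {-1, 0, 1}" by force
  \<comment> \<open>The centres of the arcs, the second one shifted by \<open>4 * q\<close>, are
    \<open>a + 1\<close> and \<open>a + 1 - r\<close>; \<open>t\<close> is their midpoint, at
    distance at most 1/2 from each.\<close>
  define t where "t = real_of_int a + 1 - real_of_int r / 2"
  have "t \<in> open_arc a" unfolding open_arc_def
    by (rule CollectI, rule exI[of _ 0]) (use ab(2) in \<open>auto simp: t_def\<close>)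
  moreover have "t \<in> open_arc b" unfolding open_arc_def
    by (rule CollectI, rule exI[of _ q]) (use ab in \<open>auto simp: t_def\<close>)
  ultimately show ?thesis by blast
qed

section \<open>Tiles meeting only in their frontiers\<close>

definition opposite :: "nat \<Rightarrow> (nat \<Rightarrow> int) \<Rightarrow> (nat \<Rightarrow> int) \<Rightarrow> bool" where
  "opposite k c d \<longleftrightarrow> (\<exists>i<k. (c i - d i) mod 4 = 2)"

lemma opposite_sym: "opposite k c d \<Longrightarrow> opposite k d c"
proof -
  have "(a - b) mod 4 = 2 \<Longrightarrow> (b - a) mod 4 = 2" for a b :: int by presburger
  then show "opposite k c d \<Longrightarrow> opposite k d c" unfolding opposite_def by blast
qed

text \<open>If \<open>x\<close> were interior, a box around it would lie in the tile; moving
  coordinate \<open>i\<close> alone would then give a neighbourhood of an arc endpoint inside the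
  arc.\<close>

lemma in_frontier_tile:
  assumes x: "x \<in> tile k c" and i: "i < k" and "x i = real_of_int (c i + 2 * m)"
  shows "x \<in> euclid k frontier_of tile k c"
proof -
  have "tile k c \<subseteq> topspace (euclid k)" by (auto simp: tile_def)
  then have "x \<in> euclid k closure_of tile k c" using x closure_of_subset by blast
  moreover have "x \<notin> euclid k interior_of tile k c"
  proof
    assume "x \<in> euclid k interior_of tile k c"
    then obtain T where T: "openin (euclid k) T" "x \<in> T" "T \<subseteq> tile k c"
      by (auto simp: interior_of_def)
    then obtain U where U: "\<And>j. j < k \<Longrightarrow> open (U j)" "x \<in> Pi\<^sub>E {..<k} U" "Pi\<^sub>E {..<k} U \<subseteq> T"
      unfolding euclid_def openin_product_topology_alt
      by (metis (no_types, lifting) lessThan_iff open_openin)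
    have "U i \<subseteq> closed_arc (c i)"
    proof
      fix t assume "t \<in> U i"
      then have "x(i := t) \<in> Pi\<^sub>E {..<k} U" using U(2) i by (auto simp: PiE_iff extensional_def)
      then have "x(i := t) \<in> (\<Pi>\<^sub>E i\<in>{..<k}. closed_arc (c i))" using U(3) T(3) tile_eq_PiE by blast
      then show "t \<in> closed_arc (c i)" using i by (force simp: PiE_iff)
    qed
    moreover have "x i \<in> U i" using U(2) i by (auto simp: PiE_iff)
    ultimately show False using arc_endpoint_not_interior U(1)[OF i] assms(3) by metis
  qed
  ultimately show ?thesis by (simp add: frontier_of_def)
qed

text \<open>In an opposite coordinate, common points sit at arc endpoints. Without such a coordinate
  the open arcs meet in every coordinate, which yields a common point interior to
  \<open>tile k c\<close>.\<close>

lemma tiles_meet_in_frontier_iff: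
  "tile k c \<inter> tile k d \<subseteq> (euclid k frontier_of tile k c) \<inter> (euclid k frontier_of tile k d)
    \<longleftrightarrow> opposite k c d" (is "?L \<longleftrightarrow> _")
proof
  have one: "x \<in> euclid k frontier_of tile k c"
    if opp: "opposite k c d" and x: "x \<in> tile k c" "x \<in> tile k d" for c d x
  proof -
    obtain i where i: "i < k" "(c i - d i) mod 4 = 2" using opp by (auto simp: opposite_def)
    moreover have "x i \<in> closed_arc (c i)" "x i \<in> closed_arc (d i)" using x i(1) by (auto simp: tile_eq_PiE)
    ultimately show ?thesis using arc_int_arc_opposite in_frontier_tile x(1) by metis
  qed
  assume "opposite k c d"
  then show ?L using one[of c d] one[of d c] opposite_sym by blast
next
  assume L: ?L
  show "opposite k c d"
  proof (rule ccontr)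
    assume "\<not> opposite k c d"
    then have "\<forall>i\<in>{..<k}. \<exists>t. t \<in> open_arc (c i) \<inter> open_arc (d i)"
      using open_arc_int_open_arc by (fastforce simp: opposite_def)
    then obtain t where t: "\<And>i. i < k \<Longrightarrow> t i \<in> open_arc (c i) \<inter> open_arc (d i)"
      by (metis lessThan_iff)
    define x where "x = restrict t {..<k}"
    define T where "T = (\<Pi>\<^sub>E i\<in>{..<k}. open_arc (c i))"
    have x: "x \<in> T" using t by (auto simp: T_def x_def)
    have T: "T \<subseteq> tile k c" using open_arc_subset by (force simp: T_def tile_eq_PiE)
    have "x \<in> tile k d" using t open_arc_subset by (force simp: x_def tile_eq_PiE)
    then have "x \<in> euclid k frontier_of tile k c" using L x T by blast
    moreover have "openin (euclid k) T"
      unfolding euclid_def T_def by (intro iffD2[OF openin_PiE]) (auto simp: open_open_arc)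
    then have "x \<in> euclid k interior_of tile k c" using x T by (auto simp: interior_of_def)
    ultimately show False by (simp add: frontier_of_def)
  qed
qed

section \<open>Covering by counting\<close>

lemma finite_cube_verts: "finite (cube_verts k)"
  by (auto simp: cube_verts_def intro: finite_PiE)

lemma card_cube_verts: "card (cube_verts k) = 2 ^ k"
  by (simp add: cube_verts_def card_PiE numeral_2_eq_2)

text \<open>Pigeonhole in place of constructions: it yields the tile covering a point, the sink of a
  face and the corner lying over a vertex.\<close>

lemma inj_on_cube_verts_imp_onto:
  assumes "inj_on h A" "card A = 2 ^ k" "h ` A \<subseteq> cube_verts k"
  shows "h ` A = cube_verts k"
  using assms by (simp add: card_image card_cube_verts card_subset_eq finite_cube_verts)

text \<open>Mapping a corner \<open>c\<close> to the coordinates in which its half-open cube contains a given point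
  \<open>x\<close> is injective on a pairwise opposite family, so some corner attains the all-ones vector.\<close>
lemma opposite_corners_cover:
  assumes card: "card C = 2 ^ k" and opp: "\<And>c d. c \<in> C \<Longrightarrow> d \<in> C \<Longrightarrow> c \<noteq> d \<Longrightarrow> opposite k c d"
  shows "(\<Union>c\<in>C. tile k c) = topspace (euclid k)"
proof
  show "(\<Union>c\<in>C. tile k c) \<subseteq> topspace (euclid k)" by (auto simp: tile_def)
  show "topspace (euclid k) \<subseteq> (\<Union>c\<in>C. tile k c)"
  proof
    fix x assume x: "x \<in> topspace (euclid k)"
    \<comment> \<open>Arc ends are integers, so the floor of \<open>x i\<close> decides whether
      \<open>x i\<close> lies, modulo 4, in the half-open arc from \<open>c i\<close> to
      \<open>c i + 2\<close>.\<close>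
    define h :: "(nat \<Rightarrow> int) \<Rightarrow> nat \<Rightarrow> nat" where
      "h c = (\<lambda>i\<in>{..<k}. if (\<lfloor>x i\<rfloor> - c i) mod 4 < 2 then 1 else 0)" for c
    have "inj_on h C"
    proof (rule inj_onI, rule ccontr)
      fix c d assume cd: "c \<in> C" "d \<in> C" "h c = h d" "c \<noteq> d"
      then obtain i where i: "i < k" "(c i - d i) mod 4 = 2" using opp by (auto simp: opposite_def)
      \<comment> \<open>Half-open arcs starting 2 apart partition the circle, so \<open>x i\<close>
        lies in exactly one of them.\<close>
      have "((\<lfloor>x i\<rfloor> - c i) mod 4 < 2) \<noteq> ((\<lfloor>x i\<rfloor> - d i) mod 4 < 2)" using i(2) by presburger
      moreover have "h c i = h d i" using cd(3) by simp
      ultimately show False using i(1) by (simp add: h_def split: if_splits)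
    qed
    moreover have "h ` C \<subseteq> cube_verts k" by (intro image_subsetI) (simp add: h_def cube_verts_def)
    ultimately have "h ` C = cube_verts k" using card inj_on_cube_verts_imp_onto by blast
    moreover have "(\<lambda>i\<in>{..<k}. 1) \<in> cube_verts k" by (auto simp: cube_verts_def)
    ultimately obtain c where c: "c \<in> C" "h c = (\<lambda>i\<in>{..<k}. 1)" by (metis imageE)
    have "x i \<in> closed_arc (c i)" if i: "i < k" for i
    proof -
      have "h c i = 1" using c(2) i by simp
      then have "(\<lfloor>x i\<rfloor> - c i) mod 4 < 2" using i by (simp add: h_def split: if_splits)
      moreover define q where "q = (\<lfloor>x i\<rfloor> - c i) div 4"
      ultimately have "\<lfloor>x i\<rfloor> - 4 * q = c i \<or> \<lfloor>x i\<rfloor> - 4 * q = c i + 1" by presburger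
      then have "real_of_int (c i) \<le> x i - 4 * of_int q" "x i - 4 * of_int q \<le> real_of_int (c i) + 2"
        by linarith+
      then show ?thesis unfolding closed_arc_def by blast
    qed
    then have "x \<in> tile k c" using x by (auto simp: tile_eq_PiE topspace_euclid PiE_iff)
    then show "x \<in> (\<Union>c\<in>C. tile k c)" using c(1) by blast
  qed
qed

text \<open>The frontier condition turns into pairwise opposition, and covering then follows by
  \<open>opposite_corners_cover\<close>.\<close>

lemma cube_tilings_iff:
  "C \<in> cube_tilings k \<longleftrightarrow> C \<subseteq> {..<k} \<rightarrow>\<^sub>E {0..3} \<and> card C = 2 ^ k \<and>
     (\<forall>c\<in>C. \<forall>d\<in>C. c \<noteq> d \<longrightarrow> opposite k c d)"
proof -
  have "(\<Union>c\<in>C. tile k c) = topspace (euclid k)"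
    if "card C = 2 ^ k" "\<forall>c\<in>C. \<forall>d\<in>C. c \<noteq> d \<longrightarrow> opposite k c d"
    using opposite_corners_cover[OF that(1)] that(2) by simp
  then show ?thesis unfolding cube_tilings_def tiles_meet_in_frontier_iff mem_Collect_eq by iprover
qed

section \<open>Outmaps of unique sink orientations\<close>

text \<open>Stated for arbitrary \<open>s\<close>, so that the values of \<open>s\<close> can be
  modified without handling edge sets.\<close>

definition unique_sinks :: "nat \<Rightarrow> ((nat \<Rightarrow> nat) \<Rightarrow> nat set) \<Rightarrow> bool" where
  "unique_sinks k s \<longleftrightarrow> (\<forall>f \<in> {..<k} \<rightarrow>\<^sub>E {None, Some 0, Some 1}.
     \<exists>!v. v \<in> face k f \<and> (\<forall>i<k. f i = None \<longrightarrow> i \<notin> s v))"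

definition szabo_welzl :: "nat \<Rightarrow> ((nat \<Rightarrow> nat) \<Rightarrow> nat set) \<Rightarrow> bool" where
  "szabo_welzl k s \<longleftrightarrow> (\<forall>u\<in>cube_verts k. \<forall>v\<in>cube_verts k. u \<noteq> v \<longrightarrow>
     (\<exists>i<k. u i \<noteq> v i \<and> (i \<in> s u \<longleftrightarrow> i \<notin> s v)))"

section \<open>Both directions of the Szabo-Welzl theorem\<close>

lemma cube_vert_bit: "v \<in> cube_verts k \<Longrightarrow> i < k \<Longrightarrow> v i = 0 \<or> v i = 1"
  by (auto simp: cube_verts_def PiE_iff)

lemma cube_verts_eqI:
  "u \<in> cube_verts k \<Longrightarrow> v \<in> cube_verts k \<Longrightarrow> (\<And>i. i < k \<Longrightarrow> u i = v i) \<Longrightarrow> u = v"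
  unfolding cube_verts_def by (rule PiE_ext) auto

lemma ex1_imp_ex_eq: "\<exists>!x. P x \<Longrightarrow> \<exists>a. \<forall>x. P x \<longleftrightarrow> x = a"
  by metis

text \<open>In a face with \<open>j\<close> free, the sinks \<open>v0\<close> and \<open>v1\<close>
  of the two facets in direction \<open>j\<close> survive the flip. Exactly one of them was the sink
  of the whole face; after the flip it is the other one.\<close>

lemma unique_sinks_flip_coordinate:
  assumes us: "unique_sinks k s"
  shows "unique_sinks k (\<lambda>v. {i. (i \<in> s v) \<noteq> (i = j)})"
  unfolding unique_sinks_def
proof
  fix f :: "nat \<Rightarrow> nat option" assume f: "f \<in> {..<k} \<rightarrow>\<^sub>E {None, Some 0, Some 1}"
  let ?sink = "\<lambda>f v. v \<in> face k f \<and> (\<forall>i<k. f i = None \<longrightarrow> i \<notin> s v)"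
  let ?sink' = "\<lambda>f v. v \<in> face k f \<and> (\<forall>i<k. f i = None \<longrightarrow> i \<notin> {i. (i \<in> s v) \<noteq> (i = j)})"
  have us': "\<exists>!v. ?sink f v" if "f \<in> {..<k} \<rightarrow>\<^sub>E {None, Some 0, Some 1}" for f
    using us that unfolding unique_sinks_def by blast
  show "\<exists>!v. ?sink' f v"
  proof (cases "j < k \<and> f j = None")
    case False
    then have "?sink' f = ?sink f" by fastforce
    then show ?thesis using us'[OF f] by simp
  next
    case True
    let ?f = "\<lambda>b. f(j := Some b)"
    have "?f 0 \<in> {..<k} \<rightarrow>\<^sub>E {None, Some 0, Some 1}" "?f 1 \<in> {..<k} \<rightarrow>\<^sub>E {None, Some 0, Some 1}"
      using f True by (auto simp: PiE_iff extensional_def)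
    note ex1 = us'[OF this(1)] us'[OF this(2)]
    obtain v0 where "\<forall>v. ?sink (?f 0) v \<longleftrightarrow> v = v0" using ex1_imp_ex_eq[OF ex1(1)] ..
    then have v0: "?sink (?f 0) v \<longleftrightarrow> v = v0" for v by (rule spec)
    obtain v1 where "\<forall>v. ?sink (?f 1) v \<longleftrightarrow> v = v1" using ex1_imp_ex_eq[OF ex1(2)] ..
    then have v1: "?sink (?f 1) v \<longleftrightarrow> v = v1" for v by (rule spec)
    have facet: "v \<in> face k (?f b) \<longleftrightarrow> v \<in> face k f \<and> v j = b" for v b
      using True by (auto simp: face_def)
    have "v0 \<noteq> v1" using v0[of v0] v1[of v1] facet by auto
    \<comment> \<open>With direction \<open>j\<close> ignored, the candidates for a sink of
      \<open>f\<close> are just the sinks of its two facets.\<close>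
    have split: "v \<in> face k f \<and> (\<forall>i<k. f i = None \<longrightarrow> i \<noteq> j \<longrightarrow> i \<notin> s v) \<longleftrightarrow> v = v0 \<or> v = v1" for v
    proof -
      have "v \<in> face k f \<Longrightarrow> v j = 0 \<or> v j = 1" using True cube_vert_bit by (auto simp: face_def)
      then show ?thesis unfolding v0[symmetric] v1[symmetric] facet by auto
    qed
    have sink: "?sink f v \<longleftrightarrow> (v = v0 \<or> v = v1) \<and> j \<notin> s v" for v
      unfolding split[symmetric] using True by auto
    have sink': "?sink' f v \<longleftrightarrow> (v = v0 \<or> v = v1) \<and> j \<in> s v" for v
      unfolding split[symmetric] using True by auto
    have "(j \<in> s v0) \<noteq> (j \<in> s v1)"
      using us'[OF f] \<open>v0 \<noteq> v1\<close> unfolding sink by metis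
    then show ?thesis unfolding sink' by metis
  qed
qed

lemma unique_sinks_flip:
  assumes "unique_sinks k s" "finite R"
  shows "unique_sinks k (\<lambda>v. {i. (i \<in> s v) \<noteq> (i \<in> R)})"
  using assms(2)
proof induction
  case empty
  then show ?case using assms(1) by simp
next
  case (insert j R)
  have "(\<lambda>v. {i. (i \<in> s v) \<noteq> (i \<in> insert j R)}) =
      (\<lambda>v. {i. (i \<in> {i. (i \<in> s v) \<noteq> (i \<in> R)}) \<noteq> (i = j)})"
    using insert.hyps by auto
  then show ?case using unique_sinks_flip_coordinate[OF insert.IH, of j] by simp
qed

text \<open>If \<open>s u\<close> and \<open>s v\<close> agree on the coordinates in which \<open>u\<close> and \<open>v\<close> differ, then flipping the
  coordinates of \<open>s u\<close> makes both \<open>u\<close> and \<open>v\<close> sinks of the face that they span.\<close>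
lemma unique_sinks_imp_szabo_welzl:
  assumes us: "unique_sinks k s"
  shows "szabo_welzl k s"
  unfolding szabo_welzl_def
proof (intro ballI impI, rule ccontr)
  fix u v assume uv: "u \<in> cube_verts k" "v \<in> cube_verts k" "u \<noteq> v"
    and no: "\<not> (\<exists>i<k. u i \<noteq> v i \<and> (i \<in> s u \<longleftrightarrow> i \<notin> s v))"
  define f where "f = (\<lambda>i\<in>{..<k}. if u i = v i then Some (u i) else None)"
  \<comment> \<open>The cut to \<open>{..<k}\<close> makes \<open>R\<close> finite, as the induction
    behind \<open>unique_sinks_flip\<close> requires.\<close>
  define R where "R = s u \<inter> {..<k}"
  have f: "f \<in> {..<k} \<rightarrow>\<^sub>E {None, Some 0, Some 1}"
    unfolding f_def restrict_PiE_iff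
  proof
    fix i assume "i \<in> {..<k}"
    then have "u i = 0 \<or> u i = 1" using cube_vert_bit[OF uv(1)] by simp
    then show "(if u i = v i then Some (u i) else None) \<in> {None, Some 0, Some 1}" by auto
  qed
  have "unique_sinks k (\<lambda>v. {i. (i \<in> s v) \<noteq> (i \<in> R)})"
    using us by (intro unique_sinks_flip) (auto simp: R_def)
  then have "\<exists>!v. v \<in> face k f \<and> (\<forall>i<k. f i = None \<longrightarrow> i \<notin> {i. (i \<in> s v) \<noteq> (i \<in> R)})"
    using f unfolding unique_sinks_def by blast
  moreover have "u \<in> face k f" "v \<in> face k f" using uv by (auto simp: face_def f_def)
  moreover have "\<forall>i<k. f i = None \<longrightarrow> i \<notin> {i. (i \<in> s u) \<noteq> (i \<in> R)}"
    "\<forall>i<k. f i = None \<longrightarrow> i \<notin> {i. (i \<in> s v) \<noteq> (i \<in> R)}"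
    using no by (auto simp: R_def f_def split: if_splits)
  ultimately show False using uv(3) by blast
qed

text \<open>For a face \<open>f\<close>, let \<open>g\<close> replace the free bits of a vertex by
  its outmap bits. The condition makes \<open>g\<close> injective on all vertices, hence bijective,
  and the sinks of \<open>f\<close> are exactly the preimages of one vertex
  \<open>z\<close>.\<close>

lemma szabo_welzl_imp_unique_sinks:
  assumes sw: "szabo_welzl k s"
  shows "unique_sinks k s"
  unfolding unique_sinks_def
proof
  fix f :: "nat \<Rightarrow> nat option" assume f: "f \<in> {..<k} \<rightarrow>\<^sub>E {None, Some 0, Some 1}"
  define g :: "(nat \<Rightarrow> nat) \<Rightarrow> nat \<Rightarrow> nat" where
    "g v = (\<lambda>i\<in>{..<k}. if f i = None then of_bool (i \<in> s v) else v i)" for v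
  \<comment> \<open>The fixed bits of \<open>f\<close> express membership in the face; the zeros at
    free coordinates say that no edge leaves inside it.\<close>
  define z where "z = (\<lambda>i\<in>{..<k}. if f i = None then 0 else the (f i))"
  have inj: "inj_on g (cube_verts k)"
  proof (rule inj_onI, rule ccontr)
    fix u v assume uv: "u \<in> cube_verts k" "v \<in> cube_verts k" "g u = g v" "u \<noteq> v"
    then obtain i where i: "i < k" "u i \<noteq> v i" "i \<in> s u \<longleftrightarrow> i \<notin> s v"
      using sw by (auto simp: szabo_welzl_def)
    \<comment> \<open>At the separating coordinate \<open>i\<close> both the vertex bits and the
      outmap bits differ, so \<open>g\<close> separates \<open>u\<close> and \<open>v\<close>
      whether \<open>i\<close> is fixed or free.\<close>
    have "g u i = g v i" using uv(3) by simp
    then show False using i by (auto simp: g_def split: if_splits)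
  qed
  have "g ` cube_verts k \<subseteq> cube_verts k"
    using cube_vert_bit by (fastforce simp: g_def cube_verts_def)
  then have onto: "g ` cube_verts k = cube_verts k"
    using inj inj_on_cube_verts_imp_onto card_cube_verts by blast
  have "f i = Some 0 \<or> f i = Some 1" if "i < k" "f i \<noteq> None" for i
    using PiE_mem[OF f, of i] that by blast
  then have "z \<in> cube_verts k" unfolding z_def cube_verts_def restrict_PiE_iff by fastforce
  then obtain v where v: "v \<in> cube_verts k" "g v = z" using onto by (metis imageE)
  have "w \<in> face k f \<and> (\<forall>i<k. f i = None \<longrightarrow> i \<notin> s w) \<longleftrightarrow> w \<in> cube_verts k \<and> g w = z" for w
  proof
    assume L: "w \<in> face k f \<and> (\<forall>i<k. f i = None \<longrightarrow> i \<notin> s w)"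
    have "g w i = z i" for i
      using L by (cases "i < k \<and> f i \<noteq> None") (auto simp: g_def z_def face_def)
    with L show "w \<in> cube_verts k \<and> g w = z" by (auto simp: face_def)
  next
    assume R: "w \<in> cube_verts k \<and> g w = z"
    have "f i = None \<Longrightarrow> i \<notin> s w" "f i \<noteq> None \<Longrightarrow> w i = the (f i)" if "i < k" for i
    proof -
      have "g w i = z i" using R by simp
      then show "f i = None \<Longrightarrow> i \<notin> s w" "f i \<noteq> None \<Longrightarrow> w i = the (f i)"
        using that by (auto simp: g_def z_def split: if_splits)
    qed
    then show "w \<in> face k f \<and> (\<forall>i<k. f i = None \<longrightarrow> i \<notin> s w)" using R by (auto simp: face_def)
  qed
  then show "\<exists>!v. v \<in> face k f \<and> (\<forall>i<k. f i = None \<longrightarrow> i \<notin> s v)"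
    using v inj by (auto simp: inj_on_def)
qed

section \<open>Orientations and their outmaps\<close>

definition flip :: "nat \<Rightarrow> (nat \<Rightarrow> nat) \<Rightarrow> nat \<Rightarrow> nat" where
  "flip i v = v(i := 1 - v i)"

definition outmap :: "nat \<Rightarrow> ((nat \<Rightarrow> nat) \<times> (nat \<Rightarrow> nat)) set \<Rightarrow> (nat \<Rightarrow> nat) \<Rightarrow> nat set" where
  "outmap k D v = {i. i < k \<and> (v, flip i v) \<in> D}"

definition outmap_arcs :: "nat \<Rightarrow> ((nat \<Rightarrow> nat) \<Rightarrow> nat set) \<Rightarrow> ((nat \<Rightarrow> nat) \<times> (nat \<Rightarrow> nat)) set" where
  "outmap_arcs k s = {(v, flip i v) | v i. v \<in> cube_verts k \<and> i < k \<and> i \<in> s v}"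

lemma flip_in_cube_verts: "v \<in> cube_verts k \<Longrightarrow> i < k \<Longrightarrow> flip i v \<in> cube_verts k"
  by (auto simp: cube_verts_def flip_def PiE_iff extensional_def)

lemma flip_neq: "v \<in> cube_verts k \<Longrightarrow> i < k \<Longrightarrow> flip i v j \<noteq> v j \<longleftrightarrow> j = i"
  using cube_vert_bit[of v k i] by (auto simp: flip_def)

lemma flip_flip: "v \<in> cube_verts k \<Longrightarrow> i < k \<Longrightarrow> flip i (flip i v) = v"
  using cube_vert_bit[of v k i] by (auto simp: flip_def)

lemma flip_eq_iff: "v \<in> cube_verts k \<Longrightarrow> i < k \<Longrightarrow> j < k \<Longrightarrow> flip i v = flip j v \<longleftrightarrow> i = j"
  by (metis flip_neq)

lemma cube_adj_iff_flip: "cube_adj k u v \<longleftrightarrow> u \<in> cube_verts k \<and> (\<exists>i<k. v = flip i u)"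
proof
  assume adj: "cube_adj k u v"
  then have uv: "u \<in> cube_verts k" "v \<in> cube_verts k" and "\<exists>!i. i < k \<and> u i \<noteq> v i"
    by (simp_all add: cube_adj_def)
  then obtain i where i: "i < k" "u i \<noteq> v i" "\<And>j. j < k \<Longrightarrow> u j \<noteq> v j \<Longrightarrow> j = i"
    by blast
  have "v = flip i u"
  proof (rule cube_verts_eqI[of _ k])
    fix j assume j: "j < k"
    show "v j = flip i u j"
    proof (cases "j = i")
      case True
      then show ?thesis
        using i(2) cube_vert_bit[OF uv(1) j] cube_vert_bit[OF uv(2) j] by (simp add: flip_def) linarith
    next
      case False
      then have "u j = v j" using i(3)[OF j] by blast
      then show ?thesis using False by (simp add: flip_def)
    qed
  qed (use uv flip_in_cube_verts[OF uv(1) i(1)] in simp_all)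
  then show "u \<in> cube_verts k \<and> (\<exists>i<k. v = flip i u)" using uv i by blast
next
  assume "u \<in> cube_verts k \<and> (\<exists>i<k. v = flip i u)"
  then obtain i where u: "u \<in> cube_verts k" "i < k" "v = flip i u" by blast
  then have "u j \<noteq> v j \<longleftrightarrow> j = i" for j using flip_neq[of u k i j] by auto
  then show "cube_adj k u v" using u flip_in_cube_verts[OF u(1,2)] by (auto simp: cube_adj_def)
qed

text \<open>The neighbours of a vertex inside a face are its flips in the free coordinates, so arcs
  leaving it there correspond to free elements of its outmap.\<close>

lemma usos_iff: "D \<in> usos k \<longleftrightarrow> orientation k D \<and> unique_sinks k (outmap k D)"
proof (cases "orientation k D")
  case True
  have "v \<in> face k f \<and> (\<forall>w \<in> face k f. (v, w) \<notin> D) \<longleftrightarrow>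
      v \<in> face k f \<and> (\<forall>i<k. f i = None \<longrightarrow> i \<notin> outmap k D v)" for f v
  proof (rule conj_cong[OF refl])
    assume v: "v \<in> face k f"
    have vV: "v \<in> cube_verts k" using v by (simp add: face_def)
    have flip_face: "flip i v \<in> face k f \<longleftrightarrow> f i = None" if i: "i < k" for i
    proof
      assume "flip i v \<in> face k f"
      then show "f i = None" using v i flip_neq[OF vV i, of i] unfolding face_def
        by (metis (mono_tags, lifting) mem_Collect_eq option.inject)
    next
      assume "f i = None"
      then show "flip i v \<in> face k f" using v i flip_in_cube_verts[OF vV i]
        by (auto simp: face_def flip_def)
    qed
    have "\<exists>i<k. w = flip i v" if "(v, w) \<in> D" for w
      using True that unfolding orientation_def cube_adj_iff_flip by blast
    then show "(\<forall>w \<in> face k f. (v, w) \<notin> D) \<longleftrightarrow> (\<forall>i<k. f i = None \<longrightarrow> i \<notin> outmap k D v)"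
      using flip_face by (fastforce simp: outmap_def)
  qed
  then show ?thesis using True by (simp add: usos_def unique_sinks_def)
qed (simp add: usos_def)

lemma outmap_arcs_outmap:
  assumes "orientation k D"
  shows "outmap_arcs k (outmap k D) = D"
proof
  show "outmap_arcs k (outmap k D) \<subseteq> D" by (auto simp: outmap_arcs_def outmap_def)
  show "D \<subseteq> outmap_arcs k (outmap k D)"
  proof
    fix a assume a: "a \<in> D"
    then have "cube_adj k (fst a) (snd a)" using assms by (auto simp: orientation_def)
    then obtain i where "fst a \<in> cube_verts k" "i < k" "a = (fst a, flip i (fst a))"
      unfolding cube_adj_iff_flip by (metis prod.collapse)
    then show "a \<in> outmap_arcs k (outmap k D)"
      using a unfolding outmap_arcs_def outmap_def by (smt (verit) mem_Collect_eq)
  qed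
qed

lemma flip_arc_iff:
  "v \<in> cube_verts k \<Longrightarrow> i < k \<Longrightarrow> (v, flip i v) \<in> outmap_arcs k s \<longleftrightarrow> i \<in> s v"
  using flip_eq_iff by (auto simp: outmap_arcs_def)

text \<open>The intersection appears because \<open>s v\<close> may contain numbers that are not
  coordinates.\<close>

lemma outmap_outmap_arcs:
  "v \<in> cube_verts k \<Longrightarrow> outmap k (outmap_arcs k s) v = s v \<inter> {..<k}"
  by (auto simp: outmap_def flip_arc_iff)

text \<open>The ends of an edge differ in one coordinate only, so the condition forces this
  coordinate to lie in the outmap of exactly one end, which gives the edge exactly one
  direction.\<close>

lemma orientation_outmap_arcs:
  assumes "szabo_welzl k s"
  shows "orientation k (outmap_arcs k s)"
proof -
  have flip: "(u, flip i u) \<in> outmap_arcs k s \<longleftrightarrow> (flip i u, u) \<notin> outmap_arcs k s"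
    if u: "u \<in> cube_verts k" "i < k" for u i
  proof -
    note w = flip_in_cube_verts[OF u]
    have "u \<noteq> flip i u" using flip_neq[OF u, of i] by metis
    then obtain j where "j < k" "u j \<noteq> flip i u j" "j \<in> s u \<longleftrightarrow> j \<notin> s (flip i u)"
      using assms u w unfolding szabo_welzl_def by blast
    moreover from this have "j = i" using flip_neq[OF u, of j] by metis
    ultimately have *: "i \<in> s u \<longleftrightarrow> i \<notin> s (flip i u)" by simp
    then show ?thesis
      using flip_arc_iff[OF u, of s] flip_arc_iff[OF w u(2), of s] unfolding flip_flip[OF u] by blast
  qed
  have "cube_adj k u v" if "(u, v) \<in> outmap_arcs k s" for u v
    using that unfolding cube_adj_iff_flip outmap_arcs_def by blast
  moreover have "(u, v) \<in> outmap_arcs k s \<longleftrightarrow> (v, u) \<notin> outmap_arcs k s" if adj: "cube_adj k u v" for u v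
  proof -
    obtain i where "u \<in> cube_verts k" "i < k" "v = flip i u"
      using adj unfolding cube_adj_iff_flip by blast
    then show ?thesis using flip by simp
  qed
  ultimately show ?thesis unfolding orientation_def by (simp add: case_prod_unfold)
qed

section \<open>The bijection\<close>

text \<open>A cyclic Gray code: adding 2 modulo 4 complements both bits.\<close>

definition code :: "nat \<Rightarrow> bool \<Rightarrow> int" where
  "code b p = (if b = 0 then of_bool p else if p then 2 else 3)"

definition corner :: "nat \<Rightarrow> ((nat \<Rightarrow> nat) \<Rightarrow> nat set) \<Rightarrow> (nat \<Rightarrow> nat) \<Rightarrow> nat \<Rightarrow> int" where
  "corner k s v = (\<lambda>i\<in>{..<k}. code (v i) (i \<in> s v))"

lemma code_range: "code b p \<in> {0..3}"
  by (auto simp: code_def)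

lemma code_eq_iff:
  "b \<in> {0, 1} \<Longrightarrow> b' \<in> {0, 1} \<Longrightarrow> code b p = code b' p' \<longleftrightarrow> b = b' \<and> p = p'"
  by (auto simp: code_def)

lemma code_diff:
  "b \<in> {0, 1} \<Longrightarrow> b' \<in> {0, 1} \<Longrightarrow> (code b p - code b' p') mod 4 = 2 \<longleftrightarrow> b \<noteq> b' \<and> p \<noteq> p'"
  by (auto simp: code_def)

lemma opposite_corner_iff:
  assumes "u \<in> cube_verts k" "v \<in> cube_verts k"
  shows "opposite k (corner k s u) (corner k s v) \<longleftrightarrow> (\<exists>i<k. u i \<noteq> v i \<and> (i \<in> s u \<longleftrightarrow> i \<notin> s v))"
proof -
  have "(corner k s u i - corner k s v i) mod 4 = 2 \<longleftrightarrow> u i \<noteq> v i \<and> (i \<in> s u \<longleftrightarrow> i \<notin> s v)"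
    if "i < k" for i
    using that cube_vert_bit[OF assms(1) that] cube_vert_bit[OF assms(2) that]
      code_diff[of "u i" "v i" "i \<in> s u" "i \<in> s v"] by (auto simp: corner_def)
  then show ?thesis by (auto simp: opposite_def)
qed

text \<open>The code is injective. Two maps \<open>s\<close> and \<open>s'\<close> are allowed in
  order to cover both injectivity of \<open>corner k s\<close> and the comparison of two USOs with
  the same tiling.\<close>

lemma corner_eqD:
  assumes "corner k s u = corner k s' v" "u \<in> cube_verts k" "v \<in> cube_verts k"
  shows "u = v" "s u \<inter> {..<k} = s' v \<inter> {..<k}"
proof -
  have *: "u i = v i \<and> (i \<in> s u \<longleftrightarrow> i \<in> s' v)" if "i < k" for i
  proof -
    have "corner k s u i = corner k s' v i" using assms(1) by simp
    then have "code (u i) (i \<in> s u) = code (v i) (i \<in> s' v)" using that by (simp add: corner_def)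
    then show ?thesis
      using cube_vert_bit[OF assms(2) that] cube_vert_bit[OF assms(3) that]
        code_eq_iff[of "u i" "v i" "i \<in> s u" "i \<in> s' v"] by auto
  qed
  then show "u = v" using assms(2,3) cube_verts_eqI by blast
  show "s u \<inter> {..<k} = s' v \<inter> {..<k}" using * by auto
qed

section \<open>From outmaps to tilings and back\<close>

lemma corners_in_cube_tilings:
  assumes "szabo_welzl k s"
  shows "corner k s ` cube_verts k \<in> cube_tilings k"
proof -
  have "inj_on (corner k s) (cube_verts k)" by (rule inj_onI) (rule corner_eqD)
  then have "card (corner k s ` cube_verts k) = 2 ^ k" by (simp add: card_image card_cube_verts)
  moreover have "corner k s v \<in> {..<k} \<rightarrow>\<^sub>E {0..3}" for v
    using code_range by (auto simp: corner_def simp del: atLeastAtMost_iff)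
  moreover have "opposite k (corner k s u) (corner k s v)"
    if "u \<in> cube_verts k" "v \<in> cube_verts k" "u \<noteq> v" for u v
    using assms that by (simp add: opposite_corner_iff szabo_welzl_def)
  ultimately show ?thesis unfolding cube_tilings_iff by blast
qed

text \<open>Opposite corners have different vertex bits, so by counting each vertex is read off
  exactly one corner of \<open>C\<close>; the outmap bits of that corner define
  \<open>s\<close>.\<close>

lemma cube_tiling_eq_corners:
  assumes C: "C \<in> cube_tilings k"
  obtains s where "szabo_welzl k s" "C = corner k s ` cube_verts k"
proof -
  have sub: "C \<subseteq> {..<k} \<rightarrow>\<^sub>E {0..3}" and card: "card C = 2 ^ k"
    and opp: "\<And>c d. c \<in> C \<Longrightarrow> d \<in> C \<Longrightarrow> c \<noteq> d \<Longrightarrow> opposite k c d"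
    using C by (simp_all add: cube_tilings_iff)
  \<comment> \<open>Decoding the vertex bit: 0 and 1 carry bit 0, while 2 and 3 carry bit 1.\<close>
  define h :: "(nat \<Rightarrow> int) \<Rightarrow> nat \<Rightarrow> nat" where
    "h c = (\<lambda>i\<in>{..<k}. if c i mod 4 < 2 then 0 else 1)" for c
  \<comment> \<open>The codes with outmap bit set are 1 and 2.\<close>
  define s where "s v = {i. inv_into C h v i \<in> {1, 2}}" for v
  have inj: "inj_on h C"
  proof (rule inj_onI, rule ccontr)
    fix c d assume cd: "c \<in> C" "d \<in> C" "h c = h d" "c \<noteq> d"
    then obtain i where i: "i < k" "(c i - d i) mod 4 = 2" using opp by (auto simp: opposite_def)
    have "(c i mod 4 < 2) \<noteq> (d i mod 4 < 2)" using i(2) by presburger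
    moreover have "h c i = h d i" using cd(3) by simp
    ultimately show False using i(1) by (simp add: h_def split: if_splits)
  qed
  have "h ` C \<subseteq> cube_verts k" by (intro image_subsetI) (simp add: h_def cube_verts_def)
  then have onto: "h ` C = cube_verts k" using inj card inj_on_cube_verts_imp_onto by blast
  have corner_h: "corner k s (h c) = c" if c: "c \<in> C" for c
  proof
    fix i
    have inv: "inv_into C h (h c) = c" using inj c by simp
    show "corner k s (h c) i = c i"
    proof (cases "i < k")
      case True
      then have "c i \<in> {0..3}" using sub c by blast
      then have "c i = 0 \<or> c i = 1 \<or> c i = 2 \<or> c i = 3" by auto
      moreover have "i \<in> s (h c) \<longleftrightarrow> c i \<in> {1, 2}" by (simp add: s_def inv)
      ultimately show ?thesis using True by (auto simp: corner_def h_def code_def)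
    next
      case False
      then show ?thesis using sub c by (auto simp: corner_def PiE_iff extensional_def)
    qed
  qed
  have C_eq: "C = corner k s ` cube_verts k"
    unfolding onto[symmetric] image_image using corner_h by simp
  moreover have "szabo_welzl k s"
    unfolding szabo_welzl_def
  proof (intro ballI impI)
    fix u v assume uv: "u \<in> cube_verts k" "v \<in> cube_verts k" "u \<noteq> v"
    then have "corner k s u \<noteq> corner k s v" using corner_eqD(1) by blast
    then have "opposite k (corner k s u) (corner k s v)" using opp uv C_eq by blast
    then show "\<exists>i<k. u i \<noteq> v i \<and> (i \<in> s u \<longleftrightarrow> i \<notin> s v)" using uv opposite_corner_iff by blast
  qed
  ultimately show ?thesis using that by blast
qed

theorem lemma13:
  fixes k :: nat
  assumes "k \<ge> 1"
  shows "\<exists>\<phi>. bij_betw \<phi> (cube_tilings k) (usos k)"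
proof -
  \<comment> \<open>The explicit map goes from USOs to tilings; the required bijection is its
    inverse.\<close>
  define \<psi> where "\<psi> D = corner k (outmap k D) ` cube_verts k" for D
  have "bij_betw \<psi> (usos k) (cube_tilings k)"
    unfolding bij_betw_def
  proof (intro conjI equalityI subsetI)
    show "inj_on \<psi> (usos k)"
    proof (rule inj_onI)
      fix D E assume D: "D \<in> usos k" and E: "E \<in> usos k" and eq: "\<psi> D = \<psi> E"
      have "outmap k D v = outmap k E v" if v: "v \<in> cube_verts k" for v
      proof -
        have "corner k (outmap k D) v \<in> \<psi> D" using v by (simp add: \<psi>_def)
        then have "corner k (outmap k D) v \<in> corner k (outmap k E) ` cube_verts k"
          by (simp only: eq \<psi>_def[symmetric])
        \<comment> \<open>A corner determines its vertex, so \<open>w\<close> can only be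
          \<open>v\<close>, and equal corner sets give pointwise equal outmaps.\<close>
        then obtain w where w: "corner k (outmap k D) v = corner k (outmap k E) w" "w \<in> cube_verts k"
          by (rule imageE)
        have "outmap k F v \<inter> {..<k} = outmap k F v" for F by (auto simp: outmap_def)
        then show ?thesis using corner_eqD[OF w(1) v w(2)] by simp
      qed
      then have "outmap_arcs k (outmap k D) = outmap_arcs k (outmap k E)"
        by (auto simp: outmap_arcs_def)
      then show "D = E" using D E outmap_arcs_outmap by (simp add: usos_iff)
    qed
  next
    fix C assume "C \<in> \<psi> ` usos k"
    then show "C \<in> cube_tilings k"
      using corners_in_cube_tilings unique_sinks_imp_szabo_welzl by (auto simp: \<psi>_def usos_iff)
  next
    fix C assume "C \<in> cube_tilings k"
    then obtain s where s: "szabo_welzl k s" "C = corner k s ` cube_verts k"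
      by (rule cube_tiling_eq_corners)
    define D where "D = outmap_arcs k s"
    have out: "outmap k D v = s v \<inter> {..<k}" if "v \<in> cube_verts k" for v
      using that by (simp add: D_def outmap_outmap_arcs)
    \<comment> \<open>Passing from \<open>s v\<close> to \<open>s v \<inter> {..<k}\<close> is
      harmless because the separating coordinate lies below \<open>k\<close>.\<close>
    then have "szabo_welzl k (outmap k D)" using s(1) by (simp add: szabo_welzl_def cong: conj_cong)
    then have "D \<in> usos k"
      using s(1) by (simp add: usos_iff D_def orientation_outmap_arcs szabo_welzl_imp_unique_sinks)
    moreover have "corner k (outmap k D) v = corner k s v" if v: "v \<in> cube_verts k" for v
      unfolding corner_def out[OF v] by (rule restrict_ext) simp
    then have "C = \<psi> D" by (simp add: \<psi>_def s(2))
    ultimately show "C \<in> \<psi> ` usos k" by (rule rev_image_eqI)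
  qed
  then show ?thesis using bij_betw_inv_into by blast
qed

end
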